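(* Let $a,b>0$ and $0<\nu,\tau<1$. If $(b-a)(\tau-\nu)\geq 0$, then $$a\#_{\tau}b\geq (a!_{\tau}b)\left(\frac{a\#_{\nu}b}{a!_{\nu}b}\right)^{\frac{\tau(1-\tau)}{\nu(1-\nu)}}.$$ If $(b-a)(\tau-\nu)\leq 0$, then $$a\#_{\tau}b\leq (a!_{\tau}b)\left(\frac{a\#_{\nu}b}{a!_{\nu}b}\right)^{\frac{\tau(1-\tau)}{\nu(1-\nu)}}.$$
   Context: For $a,b>0$ and $0\le t\le 1$: $a\#_t b=a^{1-t}b^t$ is the weighted geometric mean and $a!_t b=((1-t)a^{-1}+tb^{-1})^{-1}$ is the weighted harmonic mean. *)

theory Defs
  imports Complex_Main
begin

text \<open>Both means are intended for \<^term>\<open>a > (0::real)\<close>, \<^term>\<open>b > (0::real)\<close>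
  and \<^term>\<open>0 \<le> (t::real) \<and> t \<le> 1\<close>; the weight \<^term>\<open>t::real\<close> is attached to the
  second number.\<close>

definition geo_mean :: "real \<Rightarrow> real \<Rightarrow> real \<Rightarrow> real" where
  "geo_mean t a b = a powr (1 - t) * b powr t"

definition harm_mean :: "real \<Rightarrow> real \<Rightarrow> real \<Rightarrow> real" where
  "harm_mean t a b = inverse ((1 - t) * inverse a + t * inverse b)"

end

theory Submission
  imports Defs
begin

text \<open>
  With \<open>x = b / a\<close>, the quotient of the geometric by the harmonic mean of weight \<open>t\<close> depends
  only on \<open>t\<close> and \<open>x\<close>.  Let \<open>K t x\<close> be its logarithm divided by \<open>t (1 - t)\<close>.  Both claims
  then compare \<open>K \<tau> x\<close> with \<open>K \<nu> x\<close>: at fixed \<open>x\<close>, the function \<open>K\<close> increases in the weight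
  if \<open>x \<ge> 1\<close> and decreases if \<open>x \<le> 1\<close>.

  Differentiating in the weight would be messy; differentiating in \<open>x\<close> is not.  The
  normalisation by \<open>t (1 - t)\<close> cancels the weights in the numerator and leaves the derivative
  \<open>(x - 1) / (x ((1 - t) x + t))\<close>.  The denominator equals \<open>x (x - t (x - 1))\<close>, so this
  derivative increases with \<open>t\<close> on both sides of \<open>x = 1\<close>.  Hence \<open>K \<tau> x - K \<nu> x\<close> increases
  in \<open>x\<close> when \<open>\<nu> \<le> \<tau>\<close>, and as it vanishes at \<open>x = 1\<close>, its sign is that of \<open>x - 1\<close>.
\<close>

definition normalized_log_ratio :: "real \<Rightarrow> real \<Rightarrow> real" where
  "normalized_log_ratio t x = (ln ((1 - t) * x + t) - (1 - t) * ln x) / (t * (1 - t))"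

lemma normalized_log_ratio_1 [simp]: "normalized_log_ratio t 1 = 0"
  by (simp add: normalized_log_ratio_def)

lemma weighted_sum_pos:
  fixes t x :: real
  assumes "0 < t" "t < 1" "0 < x"
  shows "0 < (1 - t) * x + t"
  using assms by (simp add: add_pos_pos)

lemma harm_mean_pos:
  assumes "0 < a" "0 < b" "0 < t" "t < 1"
  shows "0 < harm_mean t a b"
  using assms by (simp add: harm_mean_def add_pos_pos)

lemma geo_mean_div_harm_mean:
  assumes "0 < a" "0 < b" "0 < t" "t < 1"
  shows "geo_mean t a b / harm_mean t a b = exp (t * (1 - t) * normalized_log_ratio t (b / a))"
proof -
  have pos: "0 < (1 - t) * (b / a) + t"
    using assms by (intro weighted_sum_pos) auto
  have harm: "inverse (harm_mean t a b) = ((1 - t) * (b / a) + t) / b"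
    using assms by (simp add: harm_mean_def field_simps)
  have geo: "geo_mean t a b = exp ((1 - t) * ln a + t * ln b)"
    using assms by (simp add: geo_mean_def powr_def exp_add)
  have "exp (t * (1 - t) * normalized_log_ratio t (b / a))
      = exp (ln ((1 - t) * (b / a) + t) - (1 - t) * (ln b - ln a))"
    using assms by (simp add: normalized_log_ratio_def ln_div)
  also have "\<dots> = exp (ln ((1 - t) * (b / a) + t) + ((1 - t) * ln a + t * ln b) - ln b)"
    by (simp add: algebra_simps)
  also have "\<dots> = ((1 - t) * (b / a) + t) * geo_mean t a b / b"
    unfolding exp_diff exp_add[of "ln ((1 - t) * (b / a) + t)"] geo
    using pos assms by simp
  also have "\<dots> = geo_mean t a b / harm_mean t a b"
    by (simp add: divide_inverse harm[unfolded divide_inverse] mult_ac)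
  finally show ?thesis ..
qed

lemma normalized_log_ratio_has_derivative:
  assumes t: "0 < t" "t < 1" and x: "0 < x"
  shows "(normalized_log_ratio t has_real_derivative (x - 1) / (x * ((1 - t) * x + t))) (at x)"
proof -
  define w where "w = (1 - t) * x + t"
  have w: "0 < w"
    unfolding w_def using weighted_sum_pos[OF t x] .
  have deriv: "(normalized_log_ratio t has_real_derivative
      ((1 - t) / w - (1 - t) / x) / (t * (1 - t))) (at x)"
    unfolding normalized_log_ratio_def w_def
    using assms w[unfolded w_def] by (auto intro!: derivative_eq_intros simp: divide_inverse)
  have "(1 - t) / w - (1 - t) / x = (1 - t) * (x - w) / (x * w)"
    using w x by (simp add: field_simps)
  also have "x - w = t * (x - 1)"
    by (simp add: w_def algebra_simps)
  finally have "((1 - t) / w - (1 - t) / x) / (t * (1 - t)) = (x - 1) / (x * w)"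
    using t by simp
  with deriv show ?thesis
    by (simp add: w_def)
qed

text \<open>
  The product of \<open>x - 1\<close> with the difference of the two denominators is
  \<open>(\<tau> - \<nu>) x (x - 1)\<^sup>2\<close>, so the factor \<open>x - 1\<close> of the derivative absorbs the change of sign
  at \<open>x = 1\<close> and no case distinction is needed.
\<close>

lemma normalized_log_ratio_derivative_mono:
  fixes x \<nu> \<tau> :: real
  assumes "0 < \<nu>" "\<nu> \<le> \<tau>" "\<tau> < 1" "0 < x"
  shows "(x - 1) / (x * ((1 - \<nu>) * x + \<nu>)) \<le> (x - 1) / (x * ((1 - \<tau>) * x + \<tau>))"
proof -
  define v w where "v = (1 - \<nu>) * x + \<nu>" and "w = (1 - \<tau>) * x + \<tau>"
  have pos: "0 < v" "0 < w"
    unfolding v_def w_def using assms by (auto intro!: weighted_sum_pos)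
  have "(x - 1) / (x * w) - (x - 1) / (x * v) = (x - 1) * (v - w) / (x * v * w)"
    using pos assms by (simp add: field_simps)
  also have "(x - 1) * (v - w) = (\<tau> - \<nu>) * (x - 1)\<^sup>2"
    by (simp add: v_def w_def algebra_simps power2_eq_square)
  also have "0 \<le> (\<tau> - \<nu>) * (x - 1)\<^sup>2 / (x * v * w)"
    using pos assms by simp
  finally show ?thesis
    by (simp add: v_def w_def)
qed

lemma normalized_log_ratio_diff_mono:
  assumes "0 < \<nu>" "\<nu> \<le> \<tau>" "\<tau> < 1" "0 < x" "x \<le> y"
  shows "normalized_log_ratio \<tau> x - normalized_log_ratio \<nu> x
       \<le> normalized_log_ratio \<tau> y - normalized_log_ratio \<nu> y"
proof (rule DERIV_nonneg_imp_nondecreasing[OF \<open>x \<le> y\<close>])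
  fix z assume "x \<le> z" "z \<le> y"
  with assms have z: "0 < z" by simp
  have "((\<lambda>z. normalized_log_ratio \<tau> z - normalized_log_ratio \<nu> z) has_real_derivative
      (z - 1) / (z * ((1 - \<tau>) * z + \<tau>)) - (z - 1) / (z * ((1 - \<nu>) * z + \<nu>))) (at z)"
    using assms z by (intro DERIV_diff normalized_log_ratio_has_derivative) auto
  moreover have "0 \<le> (z - 1) / (z * ((1 - \<tau>) * z + \<tau>)) - (z - 1) / (z * ((1 - \<nu>) * z + \<nu>))"
    using normalized_log_ratio_derivative_mono[of \<nu> \<tau> z] assms z by simp
  ultimately show "\<exists>d. ((\<lambda>z. normalized_log_ratio \<tau> z - normalized_log_ratio \<nu> z)
      has_real_derivative d) (at z) \<and> 0 \<le> d"
    by blast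
qed

lemma normalized_log_ratio_mono_weight:
  assumes "0 < \<nu>" "\<nu> \<le> \<tau>" "\<tau> < 1" "1 \<le> x"
  shows "normalized_log_ratio \<nu> x \<le> normalized_log_ratio \<tau> x"
  using normalized_log_ratio_diff_mono[of \<nu> \<tau> 1 x] assms by simp

lemma normalized_log_ratio_antimono_weight:
  assumes "0 < \<nu>" "\<nu> \<le> \<tau>" "\<tau> < 1" "0 < x" "x \<le> 1"
  shows "normalized_log_ratio \<tau> x \<le> normalized_log_ratio \<nu> x"
  using normalized_log_ratio_diff_mono[of \<nu> \<tau> x 1] assms by simp

lemma normalized_log_ratio_le:
  assumes "0 < a" "0 < b" "0 < s" "s < 1" "0 < t" "t < 1"
    and "0 \<le> (b - a) * (t - s)"
  shows "normalized_log_ratio s (b / a) \<le> normalized_log_ratio t (b / a)"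
proof -
  consider "a \<le> b" "s \<le> t" | "b \<le> a" "t \<le> s"
    using assms(7) by (auto simp: zero_le_mult_iff)
  then show ?thesis
  proof cases
    case 1
    then show ?thesis
      using assms by (intro normalized_log_ratio_mono_weight) auto
  next
    case 2
    then show ?thesis
      using assms by (intro normalized_log_ratio_antimono_weight) auto
  qed
qed

theorem corollary2p17:
  fixes a b \<nu> \<tau> :: real
  assumes "a > 0" and "b > 0"
    and "0 < \<nu>" and "\<nu> < 1" and "0 < \<tau>" and "\<tau> < 1"
  shows "((b - a) * (\<tau> - \<nu>) \<ge> 0 \<longrightarrow>
           geo_mean \<tau> a b \<ge> harm_mean \<tau> a b *
             (geo_mean \<nu> a b / harm_mean \<nu> a b) powr (\<tau> * (1 - \<tau>) / (\<nu> * (1 - \<nu>)))) \<and>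
         ((b - a) * (\<tau> - \<nu>) \<le> 0 \<longrightarrow>
           geo_mean \<tau> a b \<le> harm_mean \<tau> a b *
             (geo_mean \<nu> a b / harm_mean \<nu> a b) powr (\<tau> * (1 - \<tau>) / (\<nu> * (1 - \<nu>))))"
proof -
  define K where "K t = normalized_log_ratio t (b / a)" for t
  have ratio: "geo_mean t a b / harm_mean t a b = exp (t * (1 - t) * K t)"
    if "0 < t" "t < 1" for t
    unfolding K_def using assms that by (intro geo_mean_div_harm_mean)
  have harm: "0 < harm_mean \<tau> a b"
    using assms by (intro harm_mean_pos)
  have geo: "geo_mean \<tau> a b = harm_mean \<tau> a b * exp (\<tau> * (1 - \<tau>) * K \<tau>)"
    using ratio[of \<tau>] harm assms by (simp add: field_simps)
  have power: "(geo_mean \<nu> a b / harm_mean \<nu> a b) powr (\<tau> * (1 - \<tau>) / (\<nu> * (1 - \<nu>)))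
      = exp (\<tau> * (1 - \<tau>) * K \<nu>)"
    using ratio[of \<nu>] assms by (simp add: powr_def)
  have weight: "0 < \<tau> * (1 - \<tau>)"
    using assms by simp
  have "K \<nu> \<le> K \<tau>" if "(b - a) * (\<tau> - \<nu>) \<ge> 0"
    unfolding K_def using assms that by (intro normalized_log_ratio_le)
  moreover have "K \<tau> \<le> K \<nu>" if "(b - a) * (\<tau> - \<nu>) \<le> 0"
    unfolding K_def using assms that
    by (intro normalized_log_ratio_le) (auto simp: algebra_simps)
  ultimately show ?thesis
    unfolding geo power using harm weight by (auto intro!: mult_left_mono)
qed

end
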